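(* Let $\bar v,\bar q,\bar\kappa,\bar\mu>0$ and let $\mathcal{L}$ be the linearized Korteweg operator with symbols $A(\xi)$, $B(\xi)$ given in the context. Then $\mathcal L$ satisfies the genuine coupling condition. Moreover, for any symbol symmetrizer of the form $$A_0(\xi)=\begin{pmatrix} a(\xi) & 0\\ 0 & a(\xi)\beta(\xi)^{-1}\end{pmatrix},\qquad \beta(\xi)=\bar q+\xi^2\bar\kappa,$$ with $a\in C^\infty(\mathbb R)$ and $a(\xi)\ge a_0>0$ for all $\xi\in\mathbb R$, the matrix symbol $A_0(\xi)A(\xi)$ is of constant multiplicity in $\xi$.
   Context: The constants arise from linearizing the one-dimensional isothermal Navier–Stokes–Korteweg system in Lagrangian coordinates $v_t-u_x=0$, $u_t+p(v)_x=\big(\tfrac{\mu(v)}{v}u_x\big)_x-\big(\kappa(v)v_{xx}+\tfrac12\kappa'(v)v_x^2\big)_x$ about a constant equilibrium state $(\bar v,\bar u)$ with $\bar v>0$ and $p'(\bar v)<0$: $\bar q=-p'(\bar v)$, $\bar\kappa=\kappa(\bar v)$, $\bar\mu=\mu(\bar v)$, all positive. The linearized operator is $\mathcal L=\sum_{j=1}^3\bar L_j\partial_x^j$ with $$\bar L_1=\begin{pmatrix}0&1\\ \bar q&0\end{pmatrix},\quad \bar L_2=\begin{pmatrix}0&0\\0&\bar\mu/\bar v\end{pmatrix},\quad \bar L_3=-\begin{pmatrix}0&0\\ \bar\kappa&0\end{pmatrix}.$$ Taking the Fourier transform of $U_t=\mathcal L U$ gives $\hat U_t+i\xi A(\xi)\hat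 U+B(\xi)\hat U=0$ with $$A(\xi)=\begin{pmatrix}0&-1\\-(\bar q+\xi^2\bar\kappa)&0\end{pmatrix},\qquad B(\xi)=\xi^2\begin{pmatrix}0&0\\0&\bar\mu/\bar v\end{pmatrix}.$$ Definitions. $\mathcal L$ satisfies the genuine coupling condition if, for all $\xi\in\mathbb R$, $\xi\ne0$, no eigenvector of $A(\xi)$ lies in $\ker B(\xi)$. A symbol symmetrizer is a smooth symmetric positive definite real matrix function $A_0(\xi)$ such that $A_0(\xi)A(\xi)$ and $A_0(\xi)B(\xi)$ are symmetric and $A_0(\xi)B(\xi)\ge0$ for all $\xi$. A symmetric matrix symbol is of constant multiplicity in $\xi$ if the number of its distinct eigenvalues and their multiplicities do not depend on $\xi\in\mathbb R$. *)

theory Defs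
  imports
    "Jordan_Normal_Form.Char_Poly"
    "Jordan_Normal_Form.Matrix_Kernel"
begin

definition smooth_fun :: "(real \<Rightarrow> real) \<Rightarrow> bool" where
  "smooth_fun f \<longleftrightarrow>
     (\<exists>D :: nat \<Rightarrow> real \<Rightarrow> real. D 0 = f \<and>
        (\<forall>m x. (D m has_real_derivative D (Suc m) x) (at x)))"

definition smooth_mat_fun :: "nat \<Rightarrow> (real \<Rightarrow> real mat) \<Rightarrow> bool" where
  "smooth_mat_fun n M \<longleftrightarrow>
     (\<forall>\<xi>. M \<xi> \<in> carrier_mat n n) \<and>
     (\<forall>i<n. \<forall>j<n. smooth_fun (\<lambda>\<xi>. M \<xi> $$ (i, j)))"

definition sym_mat :: "nat \<Rightarrow> real mat \<Rightarrow> bool" where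
  "sym_mat n M \<longleftrightarrow> M \<in> carrier_mat n n \<and> transpose_mat M = M"

definition pos_def_mat :: "nat \<Rightarrow> real mat \<Rightarrow> bool" where
  "pos_def_mat n M \<longleftrightarrow> sym_mat n M \<and>
     (\<forall>x \<in> carrier_vec n. x \<noteq> 0\<^sub>v n \<longrightarrow> x \<bullet> (M *\<^sub>v x) > 0)"

definition pos_semidef_mat :: "nat \<Rightarrow> real mat \<Rightarrow> bool" where
  "pos_semidef_mat n M \<longleftrightarrow> sym_mat n M \<and>
     (\<forall>x \<in> carrier_vec n. x \<bullet> (M *\<^sub>v x) \<ge> 0)"

text \<open>The matrices are real, but they act on Fourier transforms, so eigenvectors and
  kernels are taken over the complex numbers; real eigenvectors are a special case.\<close>

definition genuinely_coupled ::
    "(real \<Rightarrow> real mat) \<Rightarrow> (real \<Rightarrow> real mat) \<Rightarrow> bool" where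
  "genuinely_coupled A B \<longleftrightarrow>
     (\<forall>\<xi>. \<xi> \<noteq> 0 \<longrightarrow>
        \<not> (\<exists>w k. eigenvector (map_mat complex_of_real (A \<xi>)) w k \<and>
                w \<in> mat_kernel (map_mat complex_of_real (B \<xi>))))"

definition symbol_symmetrizer ::
    "nat \<Rightarrow> (real \<Rightarrow> real mat) \<Rightarrow> (real \<Rightarrow> real mat) \<Rightarrow> (real \<Rightarrow> real mat) \<Rightarrow> bool" where
  "symbol_symmetrizer n A B A0 \<longleftrightarrow>
     smooth_mat_fun n A0 \<and>
     (\<forall>\<xi>. pos_def_mat n (A0 \<xi>) \<and>
          sym_mat n (A0 \<xi> * A \<xi>) \<and>
          sym_mat n (A0 \<xi> * B \<xi>) \<and>
          pos_semidef_mat n (A0 \<xi> * B \<xi>))"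

text \<open>The distinct real eigenvalues in increasing order, each replaced by its multiplicity;
  the length of the list is the number of distinct eigenvalues.  This is only used for
  symmetric matrices: their spectrum is real, and algebraic and geometric multiplicities
  agree.\<close>

definition eigenvalue_mults :: "real mat \<Rightarrow> nat list" where
  "eigenvalue_mults M =
     map (\<lambda>k. Polynomial.order k (char_poly M)) (sorted_list_of_set {k. eigenvalue M k})"

definition constant_multiplicity :: "nat \<Rightarrow> (real \<Rightarrow> real mat) \<Rightarrow> bool" where
  "constant_multiplicity n S \<longleftrightarrow>
     (\<forall>\<xi>. sym_mat n (S \<xi>)) \<and>
     (\<forall>\<xi> \<eta>. eigenvalue_mults (S \<xi>) = eigenvalue_mults (S \<eta>))"

text \<open>Coefficient matrices of the linearized operator
  \<open>L\<^sub>1 \<partial>\<^sub>x + L\<^sub>2 \<partial>\<^sub>x\<^sup>2 + L\<^sub>3 \<partial>\<^sub>x\<^sup>3\<close>.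
  Here \<open>v\<close>, \<open>q\<close>, \<open>\<kappa>\<close>, \<open>\<mu>\<close> are the values at the equilibrium state.\<close>

definition korteweg_L1 :: "real \<Rightarrow> real mat" where
  "korteweg_L1 q = mat_of_rows_list 2 [[0, 1], [q, 0]]"

definition korteweg_L2 :: "real \<Rightarrow> real \<Rightarrow> real mat" where
  "korteweg_L2 v \<mu> = mat_of_rows_list 2 [[0, 0], [0, \<mu> / v]]"

definition korteweg_L3 :: "real \<Rightarrow> real mat" where
  "korteweg_L3 \<kappa> = - mat_of_rows_list 2 [[0, 0], [\<kappa>, 0]]"

definition korteweg_beta :: "real \<Rightarrow> real \<Rightarrow> real \<Rightarrow> real" where
  "korteweg_beta q \<kappa> \<xi> = q + \<xi>\<^sup>2 * \<kappa>"

definition korteweg_A :: "real \<Rightarrow> real \<Rightarrow> real \<Rightarrow> real mat" where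
  "korteweg_A q \<kappa> \<xi> = mat_of_rows_list 2 [[0, -1], [- korteweg_beta q \<kappa> \<xi>, 0]]"

definition korteweg_B :: "real \<Rightarrow> real \<Rightarrow> real \<Rightarrow> real mat" where
  "korteweg_B v \<mu> \<xi> = \<xi>\<^sup>2 \<cdot>\<^sub>m mat_of_rows_list 2 [[0, 0], [0, \<mu> / v]]"

text \<open>On the Fourier side \<open>\<partial>\<^sub>x\<close> becomes multiplication by \<open>\<i> \<xi>\<close>, and the equation reads
  \<open>U\<^sub>t + (\<i> \<xi> A(\<xi>) + B(\<xi>)) U = 0\<close>.\<close>

lemma korteweg_symbol:
  fixes v q \<kappa> \<mu> \<xi> :: real
  defines "z \<equiv> \<i> * complex_of_real \<xi>"
  shows "z \<cdot>\<^sub>m map_mat complex_of_real (korteweg_A q \<kappa> \<xi>)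
           + map_mat complex_of_real (korteweg_B v \<mu> \<xi>)
         = - (z \<cdot>\<^sub>m map_mat complex_of_real (korteweg_L1 q)
              + z ^ 2 \<cdot>\<^sub>m map_mat complex_of_real (korteweg_L2 v \<mu>)
              + z ^ 3 \<cdot>\<^sub>m map_mat complex_of_real (korteweg_L3 \<kappa>))"
  by (rule eq_matI)
     (auto simp: z_def korteweg_A_def korteweg_B_def korteweg_L1_def korteweg_L2_def
        korteweg_L3_def korteweg_beta_def mat_of_rows_list_def numeral_2_eq_2 less_Suc_eq
        power2_eq_square power3_eq_cube algebra_simps)

definition korteweg_A0 :: "real \<Rightarrow> real \<Rightarrow> (real \<Rightarrow> real) \<Rightarrow> real \<Rightarrow> real mat" where
  "korteweg_A0 q \<kappa> a \<xi> =
     mat_of_rows_list 2 [[a \<xi>, 0], [0, a \<xi> * inverse (korteweg_beta q \<kappa> \<xi>)]]"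

end

theory Submission
  imports Defs
begin

text \<open>Both claims rest on \<open>korteweg_beta\<close> being positive. For \<xi> nonzero, ker
  B(\<xi>) is the line of vectors (w0, 0), and A(\<xi>) sends such a vector to (0, - \<beta> w0),
  which is parallel to it only if w0 = 0 (\<open>genuinely_coupled_korteweg\<close>). The factor
  1/\<beta> in A0 cancels the \<beta> in A, so A0 A is - a(\<xi>) times the coordinate swap
  (\<open>korteweg_A0_mult_A\<close>). Its eigenvalues are a(\<xi>) and - a(\<xi>), simple and
  distinct because a(\<xi>) > 0 (\<open>eigenvalue_mults_antidiagonal\<close>).\<close>

lemma det_2:
  assumes A: "A \<in> carrier_mat 2 2"
  shows "det A = A $$ (0, 0) * A $$ (1, 1) - A $$ (0, 1) * A $$ (1, 0)"
proof -
  have "det A = (\<Sum>j<2. A $$ (0, j) * cofactor A 0 j)"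
    using A by (intro laplace_expansion_row) auto
  then show ?thesis
    using A by (simp add: numeral_2_eq_2 cofactor_def mat_delete_def det_single)
qed

lemma char_poly_2:
  fixes a b c d :: "'a::comm_ring_1"
  shows "char_poly (mat_of_rows_list 2 [[a, b], [c, d]]) = [:- a, 1:] * [:- d, 1:] - [:b * c:]"
proof -
  have "char_poly_matrix (mat_of_rows_list 2 [[a, b], [c, d]]) \<in> carrier_mat 2 2"
    by (rule char_poly_matrix_closed) (simp add: mat_of_rows_list_def numeral_2_eq_2)
  from det_2[OF this] show ?thesis
    by (simp add: char_poly_def char_poly_matrix_def mat_of_rows_list_def)
qed

text \<open>The characteristic polynomial is X^2 - c^2, with two different simple roots. The
  resulting list does not depend on \<open>c\<close>, which is what gives constancy in
  \<xi>.\<close>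

lemma eigenvalue_mults_antidiagonal:
  assumes "c > 0"
  shows "eigenvalue_mults (mat_of_rows_list 2 [[0, - c], [- c, 0]]) = [1, 1]"
proof -
  let ?M = "mat_of_rows_list 2 [[0, - c], [- c, 0]]"
  \<comment> \<open>The double negation puts the second factor in the form \<open>[:- r, 1:]\<close>
    with root \<open>r = - c\<close>, as \<open>order_power_n_n\<close> expects.\<close>
  have p: "char_poly ?M = [:- c, 1:] * [:- (- c), 1:]"
    by (simp add: char_poly_2)
  have "{k. eigenvalue ?M k} = {- c, c}"
    using eigenvalue_root_char_poly[of ?M 2] p
    by (auto simp: mat_of_rows_list_def numeral_2_eq_2 square_eq_iff)
  moreover have "sorted_list_of_set {- c, c} = [- c, c]"
    using assms by simp
  \<comment> \<open>At each root one linear factor has order 1, and the other has order 0 since it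
    does not vanish there (c differs from - c).\<close>
  moreover have "Polynomial.order c (char_poly ?M) = 1" "Polynomial.order (- c) (char_poly ?M) = 1"
    unfolding p using assms order_power_n_n[of c 1] order_power_n_n[of "- c" 1]
    by (subst order_mult; simp add: order_0I)+
  ultimately show ?thesis
    by (simp add: eigenvalue_mults_def)
qed

lemma korteweg_beta_pos:
  assumes "q > 0" "\<kappa> > 0"
  shows "korteweg_beta q \<kappa> \<xi> > 0"
  using assms by (simp add: korteweg_beta_def add_pos_nonneg)

lemma korteweg_A0_mult_A:
  assumes "korteweg_beta q \<kappa> \<xi> \<noteq> 0"
  shows "korteweg_A0 q \<kappa> a \<xi> * korteweg_A q \<kappa> \<xi> = mat_of_rows_list 2 [[0, - a \<xi>], [- a \<xi>, 0]]"
  using assms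
  by (intro eq_matI)
     (auto simp: korteweg_A0_def korteweg_A_def mat_of_rows_list_def scalar_prod_def
        numeral_2_eq_2 less_Suc_eq)

lemma genuinely_coupled_korteweg:
  assumes "v \<noteq> 0" "\<mu> \<noteq> 0" and beta: "\<And>\<xi>. korteweg_beta q \<kappa> \<xi> \<noteq> 0"
  shows "genuinely_coupled (korteweg_A q \<kappa>) (korteweg_B v \<mu>)"
  unfolding genuinely_coupled_def
proof (intro allI impI notI, elim exE conjE)
  fix \<xi> :: real and w k
  assume "\<xi> \<noteq> 0"
    and ev: "eigenvector (map_mat complex_of_real (korteweg_A q \<kappa> \<xi>)) w k"
    and "w \<in> mat_kernel (map_mat complex_of_real (korteweg_B v \<mu> \<xi>))"
  then have w: "w \<in> carrier_vec 2"
    and Bw: "(map_mat complex_of_real (korteweg_B v \<mu> \<xi>) *\<^sub>v w) $ 1 = 0"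
    by (auto simp: mat_kernel_def korteweg_B_def mat_of_rows_list_def)
  \<comment> \<open>The only nonzero entry of B(\<xi>) is \<xi>^2 \<mu> / v, at position (1,
    1).\<close>
  from Bw w \<open>\<xi> \<noteq> 0\<close> assms(1,2) have w1: "w $ 1 = 0"
    by (simp add: korteweg_B_def mat_of_rows_list_def scalar_prod_def numeral_2_eq_2)
  from ev have nz: "w \<noteq> 0\<^sub>v 2"
    and Aw: "map_mat complex_of_real (korteweg_A q \<kappa> \<xi>) *\<^sub>v w = k \<cdot>\<^sub>v w"
    by (auto simp: eigenvector_def korteweg_A_def mat_of_rows_list_def)
  \<comment> \<open>The second row of the eigenvalue equation reads - \<beta> w0 = k w1, and w1 =
    0.\<close>
  from arg_cong[OF Aw, of "\<lambda>x. x $ 1"] w w1 beta[of \<xi>] have "w $ 0 = 0"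
    by (simp add: korteweg_A_def mat_of_rows_list_def scalar_prod_def numeral_2_eq_2)
  with w w1 have "w = 0\<^sub>v 2"
    by (intro eq_vecI) (auto simp: numeral_2_eq_2 less_Suc_eq)
  with nz show False ..
qed

theorem lemma4p8:
  fixes v q \<kappa> \<mu> :: real
  assumes "v > 0" and "q > 0" and "\<kappa> > 0" and "\<mu> > 0"
  shows "genuinely_coupled (korteweg_A q \<kappa>) (korteweg_B v \<mu>) \<and>
    (\<forall>(a :: real \<Rightarrow> real) (a0 :: real).
       smooth_fun a \<and> a0 > 0 \<and> (\<forall>\<xi>. a \<xi> \<ge> a0) \<and>
       symbol_symmetrizer 2 (korteweg_A q \<kappa>) (korteweg_B v \<mu>) (korteweg_A0 q \<kappa> a)
       \<longrightarrow> constant_multiplicity 2 (\<lambda>\<xi>. korteweg_A0 q \<kappa> a \<xi> * korteweg_A q \<kappa> \<xi>))"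
proof (intro conjI allI impI, goal_cases)
  case 1
  show ?case
    using assms korteweg_beta_pos[of q \<kappa>]
    by (intro genuinely_coupled_korteweg) (auto simp: less_le)
next
  case (2 a a0)
  then have "a \<xi> > 0" for \<xi>
    using less_le_trans by blast
  moreover have "korteweg_A0 q \<kappa> a \<xi> * korteweg_A q \<kappa> \<xi>
      = mat_of_rows_list 2 [[0, - a \<xi>], [- a \<xi>, 0]]" for \<xi>
    using korteweg_beta_pos[of q \<kappa> \<xi>] assms by (intro korteweg_A0_mult_A) simp
  \<comment> \<open>Symmetry of the product comes from the symmetrizer hypothesis; the multiplicity
    list is \<open>[1, 1]\<close> at every \<xi>.\<close>
  ultimately show ?case
    using 2 by (simp add: constant_multiplicity_def symbol_symmetrizer_def
        eigenvalue_mults_antidiagonal)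
qed

end
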